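(* Let $d\ge 2$ and $n\ge 2$ be integers and let $C=(c(i_1,\ldots,i_d))$ be a $d$-dimensional $n\times n\times\cdots\times n$ real array. The instance of the planar $d$-dimensional assignment problem, i.e. the $(d,d-1)$-AP, with cost array $C$ has the constant objective value property (COVP) if and only if $C$ is a sum-decomposable array with parameters $d$ and $d-1$.
   Context: A feasible solution of the $(d,d-1)$-AP of size $n$ is a set $F\subseteq\{1,\ldots,n\}^d$ of $d$-tuples such that for every coordinate $k\in\{1,\ldots,d\}$ and every choice of values in $\{1,\ldots,n\}$ for the other $d-1$ coordinates, there is exactly one element of $F$ having these values in these $d-1$ coordinates. The objective value of $F$ with respect to the cost array $C$ is $\sum_{(i_1,\ldots,i_d)\in F}c(i_1,\ldots,i_d)$. An instance has the constant objective value property (COVP) if all feasible solutions have the same objective value. The array $C$ is sum-decomposable with parameters $d$ and $d-1$ if there exist $d$ real-valued functions ($(d-1)$-dimensional arrays) $a_1,\ldots,a_d\colon\{1,\ldots,n\}^{d-1}\to\mathbb{R}$ such that $c(i_1,\ldots,i_d)=\sum_{k=1}^d a_k(i_1,\ldots,i_{k-1},i_{k+1},\ldots,i_d)$ for all $(i_1,\ldots,i_d)\in\{1,\ldots,n\}^d$. *)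

theory Defs
  imports Complex_Main
begin

(* A d-tuple (i_1, ..., i_d) over {1..n} is a list of length d; its coordinate i_(k+1) is the
   list element at position k < d.  A d-dimensional array is a function on lists, of which only
   the values on tuples d n matter. *)

definition tuples :: "nat \<Rightarrow> nat \<Rightarrow> nat list set" where
  "tuples d n = {xs. length xs = d \<and> set xs \<subseteq> {1..n}}"

(* (i_1, ..., i_k, i_(k+2), ..., i_d): positions are counted from 0. *)
definition drop_coord :: "nat \<Rightarrow> 'a list \<Rightarrow> 'a list" where
  "drop_coord k xs = take k xs @ drop (Suc k) xs"

definition planar_ap_feasible :: "nat \<Rightarrow> nat \<Rightarrow> nat list set \<Rightarrow> bool" where
  "planar_ap_feasible d n F \<longleftrightarrow>
     F \<subseteq> tuples d n \<and>
     (\<forall>k<d. \<forall>ys\<in>tuples (d - 1) n. \<exists>!xs. xs \<in> F \<and> drop_coord k xs = ys)"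

definition objective_value :: "(nat list \<Rightarrow> real) \<Rightarrow> nat list set \<Rightarrow> real" where
  "objective_value c F = (\<Sum>xs\<in>F. c xs)"

definition planar_ap_COVP :: "nat \<Rightarrow> nat \<Rightarrow> (nat list \<Rightarrow> real) \<Rightarrow> bool" where
  "planar_ap_COVP d n c \<longleftrightarrow>
     (\<forall>F G. planar_ap_feasible d n F \<longrightarrow> planar_ap_feasible d n G \<longrightarrow>
        objective_value c F = objective_value c G)"

definition sum_decomposable :: "nat \<Rightarrow> nat \<Rightarrow> (nat list \<Rightarrow> real) \<Rightarrow> bool" where
  "sum_decomposable d n c \<longleftrightarrow>
     (\<exists>a :: nat \<Rightarrow> nat list \<Rightarrow> real.
        \<forall>xs\<in>tuples d n. c xs = (\<Sum>k<d. a k (drop_coord k xs)))"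

end

theory Submission
  imports Defs "HOL-Combinatorics.Transposition" "HOL-Number_Theory.Cong"
begin

text \<open>Necessity rests on a character sum. If \<open>\<omega>\<close> is a primitive \<open>n\<close>-th root of unity and each \<open>\<pi> k\<close> is a
  bijection onto the residues mod \<open>n\<close>, the sets \<open>\<Sum>k. \<pi> k (y k) = r (mod n)\<close> are feasible, so COVP
  makes \<open>c\<close> orthogonal to \<open>\<Prod>k. \<omega> ^ \<pi> k (y k)\<close>. Two bijections that differ by a transposition of
  the values \<open>1\<close> and \<open>x\<close> yield a multiple of the difference of the indicators of \<open>x\<close> and \<open>1\<close>, so by
  multilinearity \<open>c\<close> is orthogonal to all products of such differences. Expanding the product by
  telescoping expresses \<open>c\<close> as a sum of arrays, each of which ignores one coordinate.\<close>

section \<open>Tuples and deletion of a coordinate\<close>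

lemma finite_tuples: "finite (tuples d n)"
  using finite_lists_length_eq[of "{1..n}" d] by (simp add: tuples_def conj_commute)

lemma nth_tuples: "xs \<in> tuples d n \<Longrightarrow> k < d \<Longrightarrow> xs ! k \<in> {1..n}"
  unfolding tuples_def using nth_mem by blast

lemma drop_coord_in_tuples:
  assumes "xs \<in> tuples d n" "k < d"
  shows "drop_coord k xs \<in> tuples (d - 1) n"
  using assms by (auto simp: tuples_def drop_coord_def dest: in_set_takeD in_set_dropD)

lemma nth_drop_coord_below:
  assumes "k < length xs" "i < k"
  shows "drop_coord k xs ! i = xs ! i"
  using assms by (simp add: drop_coord_def nth_append)

lemma nth_drop_coord_above:
  assumes "k < i" "i < length xs"
  shows "drop_coord k xs ! (i - 1) = xs ! i"
  using assms by (cases i) (auto simp: drop_coord_def nth_append min_def)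

text \<open>A fiber of \<open>drop_coord k\<close> is a line in direction \<open>k\<close>,
  parametrized by the value inserted there. This turns the exactly-one condition of feasibility into
  a question about a single value.\<close>

lemma tuples_fiber_drop_coord:
  assumes ys: "ys \<in> tuples (d - 1) n" and k: "k < d"
  shows "xs \<in> tuples d n \<and> drop_coord k xs = ys \<longleftrightarrow>
    (\<exists>v\<in>{1..n}. xs = take k ys @ v # drop k ys)"
proof
  assume *: "xs \<in> tuples d n \<and> drop_coord k xs = ys"
  then have l: "k < length xs" using k by (simp add: tuples_def)
  have "take k ys = take k xs" "drop k ys = drop (Suc k) xs"
    using * l by (auto simp: drop_coord_def)
  then have "xs = take k ys @ xs ! k # drop k ys"
    using id_take_nth_drop[OF l] by simp
  then show "\<exists>v\<in>{1..n}. xs = take k ys @ v # drop k ys"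
    using nth_tuples * k by blast
next
  assume "\<exists>v\<in>{1..n}. xs = take k ys @ v # drop k ys"
  then show "xs \<in> tuples d n \<and> drop_coord k xs = ys"
    using ys k subset_trans[OF set_take_subset[of k ys], of "{1..n}"]
      subset_trans[OF set_drop_subset[of k ys], of "{1..n}"]
    by (auto simp: tuples_def drop_coord_def min_def simp del: atLeastAtMost_iff)
qed

section \<open>Sufficiency of sum-decomposability\<close>

lemma bij_betw_drop_coord_feasible:
  assumes "planar_ap_feasible d n F" "k < d"
  shows "bij_betw (drop_coord k) F (tuples (d - 1) n)"
proof -
  have F: "F \<subseteq> tuples d n"
    and ex: "\<And>ys. ys \<in> tuples (d - 1) n \<Longrightarrow> \<exists>!xs. xs \<in> F \<and> drop_coord k xs = ys"
    using assms by (auto simp: planar_ap_feasible_def)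
  have im: "drop_coord k xs \<in> tuples (d - 1) n" if "xs \<in> F" for xs
    using F that assms(2) drop_coord_in_tuples by blast
  show ?thesis
  proof (rule bij_betw_imageI)
    show "inj_on (drop_coord k) F"
    proof (rule inj_onI)
      fix xs ys assume "xs \<in> F" "ys \<in> F" "drop_coord k xs = drop_coord k ys"
      then show "xs = ys" using ex[OF im[of xs]] by metis
    qed
    show "drop_coord k ` F = tuples (d - 1) n"
    proof
      show "drop_coord k ` F \<subseteq> tuples (d - 1) n" using im by blast
      show "tuples (d - 1) n \<subseteq> drop_coord k ` F"
      proof
        fix ys assume "ys \<in> tuples (d - 1) n"
        then obtain xs where "xs \<in> F" "drop_coord k xs = ys" using ex by blast
        then show "ys \<in> drop_coord k ` F" by blast
      qed
    qed
  qed
qed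

text \<open>Each \<open>drop_coord k\<close> maps a feasible \<open>F\<close> bijectively onto all
  shorter tuples, so the \<open>k\<close>-th summand has the same total for every feasible
  \<open>F\<close>.\<close>

lemma sum_decomposable_imp_COVP:
  assumes "sum_decomposable d n c"
  shows "planar_ap_COVP d n c"
proof -
  obtain a where a: "\<And>xs. xs \<in> tuples d n \<Longrightarrow> c xs = (\<Sum>k<d. a k (drop_coord k xs))"
    using assms by (auto simp: sum_decomposable_def)
  have "objective_value c F = (\<Sum>k<d. \<Sum>ys\<in>tuples (d - 1) n. a k ys)"
    if F: "planar_ap_feasible d n F" for F
  proof -
    have "objective_value c F = (\<Sum>xs\<in>F. \<Sum>k<d. a k (drop_coord k xs))"
      unfolding objective_value_def using F a
      by (intro sum.cong) (auto simp: planar_ap_feasible_def)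
    also have "\<dots> = (\<Sum>k<d. \<Sum>xs\<in>F. a k (drop_coord k xs))"
      by (rule sum.swap)
    also have "\<dots> = (\<Sum>k<d. \<Sum>ys\<in>tuples (d - 1) n. a k ys)"
      using bij_betw_drop_coord_feasible[OF F]
      by (intro sum.cong refl sum.reindex_bij_betw) auto
    finally show ?thesis .
  qed
  then show ?thesis by (simp add: planar_ap_COVP_def)
qed

section \<open>Feasible sets from residue classes\<close>

lemma bij_betw_add_mod:
  fixes n s :: nat
  shows "bij_betw (\<lambda>w. (w + s) mod n) {..<n} {..<n}"
proof -
  have inj: "inj_on (\<lambda>w. (w + s) mod n) {..<n}"
  proof (rule inj_onI)
    fix x y assume *: "x \<in> {..<n}" "y \<in> {..<n}" "(x + s) mod n = (y + s) mod n"
    then have "[x = y] (mod n)"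
      unfolding cong_def[symmetric] cong_add_rcancel_nat by blast
    then show "x = y"
      using * by (intro cong_less_modulus_unique_nat[of x y n]) auto
  qed
  show ?thesis
    by (intro bij_betw_imageI inj endo_inj_surj[OF _ _ inj]) auto
qed

text \<open>Along a line in direction \<open>k\<close> only the \<open>k\<close>-th summand varies,
  and it runs through all residues once, so exactly one point of the line has residue
  \<open>r\<close>.\<close>

lemma feasible_residue_class:
  fixes p :: "nat \<Rightarrow> nat \<Rightarrow> nat"
  assumes p: "\<And>k. k < d \<Longrightarrow> bij_betw (p k) {1..n} {..<n}" and r: "r < n"
  shows "planar_ap_feasible d n {xs \<in> tuples d n. (\<Sum>k<d. p k (xs ! k)) mod n = r}"
    (is "planar_ap_feasible d n ?F")
  unfolding planar_ap_feasible_def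
proof (intro conjI allI impI ballI)
  show "?F \<subseteq> tuples d n" by blast
next
  fix k ys assume k: "k < d" and ys: "ys \<in> tuples (d - 1) n"
  define g where "g v = take k ys @ v # drop k ys" for v
  \<comment> \<open>The inserted 0 is a dummy: position \<open>k\<close> is left out of this
    sum.\<close>
  define s where "s = (\<Sum>i\<in>{..<d} - {k}. p i (g 0 ! i))"
  have lys: "k \<le> length ys" using k ys by (auto simp: tuples_def)
  have sum: "(\<Sum>i<d. p i (g v ! i)) = p k v + s" for v
  proof -
    have "(\<Sum>i<d. p i (g v ! i)) = p k (g v ! k) + (\<Sum>i\<in>{..<d} - {k}. p i (g v ! i))"
      using k by (intro sum.remove) auto
    also have "g v ! k = v" using lys by (simp add: g_def nth_append)
    also have "(\<Sum>i\<in>{..<d} - {k}. p i (g v ! i)) = s"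
      unfolding s_def using lys
      by (intro sum.cong) (auto simp: g_def nth_append nth_Cons')
    finally show ?thesis .
  qed
  have "bij_betw ((\<lambda>w. (w + s) mod n) \<circ> p k) {1..n} {..<n}"
    using p[OF k] bij_betw_add_mod by (rule bij_betw_trans)
  then have inj: "inj_on (\<lambda>v. (p k v + s) mod n) {1..n}"
    and im: "(\<lambda>v. (p k v + s) mod n) ` {1..n} = {..<n}"
    by (simp_all add: bij_betw_def comp_def)
  have "r \<in> (\<lambda>v. (p k v + s) mod n) ` {1..n}"
    unfolding im using r by simp
  then obtain v where v: "v \<in> {1..n}" "(p k v + s) mod n = r" by blast
  have uniq: "u = v" if "u \<in> {1..n}" "(p k u + s) mod n = r" for u
    using inj_onD[OF inj _ that(1) v(1)] that(2) v(2) by simp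
  have fiber: "xs \<in> tuples d n \<and> drop_coord k xs = ys \<longleftrightarrow> (\<exists>v\<in>{1..n}. xs = g v)" for xs
    unfolding g_def by (rule tuples_fiber_drop_coord[OF ys k])
  show "\<exists>!xs. xs \<in> ?F \<and> drop_coord k xs = ys"
  proof (rule ex1I[of _ "g v"])
    show "g v \<in> ?F \<and> drop_coord k (g v) = ys"
      using fiber[of "g v"] v sum by auto
    fix xs assume xs: "xs \<in> ?F \<and> drop_coord k xs = ys"
    then obtain u where u: "u \<in> {1..n}" "xs = g u" using fiber by blast
    then show "xs = g v" using uniq[of u] xs sum by auto
  qed
qed

section \<open>Character sums and differences of indicators\<close>

lemma root_of_unity_sum_eq_0:
  fixes w :: complex
  assumes "w ^ n = 1" "w \<noteq> 1"
  shows "(\<Sum>r<n. w ^ r) = 0"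
  using assms by (simp add: geometric_sum)

text \<open>The classes \<open>F r\<close> partition the tuples, and the character equals
  \<open>w ^ r\<close> on \<open>F r\<close>. By COVP all classes have the same objective value, so
  a multiple of the vanishing sum of the powers of \<open>w\<close> remains.\<close>

lemma COVP_character_sum:
  fixes p :: "nat \<Rightarrow> nat \<Rightarrow> nat" and w :: complex
  assumes covp: "planar_ap_COVP d n c" and n: "n > 0" and w: "w ^ n = 1" "w \<noteq> 1"
    and p: "\<And>k. k < d \<Longrightarrow> bij_betw (p k) {1..n} {..<n}"
  shows "(\<Sum>y\<in>tuples d n. of_real (c y) * (\<Prod>k<d. w ^ p k (y ! k))) = 0"
proof -
  define S where "S y = (\<Sum>k<d. p k (y ! k))" for y
  define F where "F r = {y \<in> tuples d n. S y mod n = r}" for r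
  have feas: "planar_ap_feasible d n (F r)" if "r < n" for r
    using feasible_residue_class[OF p that] by (simp add: F_def S_def)
  have wm: "w ^ m = w ^ (m mod n)" for m
  proof -
    have "w ^ m = w ^ (n * (m div n) + m mod n)" by simp
    also have "\<dots> = w ^ (m mod n)" by (simp only: power_add power_mult w power_one mult_1)
    finally show ?thesis .
  qed
  have "(\<Sum>y\<in>tuples d n. of_real (c y) * (\<Prod>k<d. w ^ p k (y ! k)))
      = (\<Sum>y\<in>tuples d n. of_real (c y) * w ^ (S y mod n))"
    by (simp add: S_def power_sum flip: wm)
  also have "\<dots> = (\<Sum>r<n. \<Sum>y\<in>F r. of_real (c y) * w ^ (S y mod n))"
    unfolding F_def using n by (intro sum.group[symmetric] finite_tuples) auto
  also have "\<dots> = (\<Sum>r<n. of_real (objective_value c (F r)) * w ^ r)"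
    by (intro sum.cong refl) (simp add: objective_value_def F_def sum_distrib_right)
  also have "\<dots> = (\<Sum>r<n. of_real (objective_value c (F 0)) * w ^ r)"
    using covp feas n unfolding planar_ap_COVP_def
    by (intro sum.cong refl arg_cong2[where f = "(*)"] arg_cong[where f = of_real]) auto
  also have "\<dots> = 0"
    by (simp add: root_of_unity_sum_eq_0 w flip: sum_distrib_left)
  finally show ?thesis .
qed

lemma bij_betw_pred_lessThan: "bij_betw (\<lambda>v. v - 1 :: nat) {1..n} {..<n}"
  by (rule bij_betw_byWitness[where f' = Suc]) auto

text \<open>The exponents 1 and 0 make \<open>w ^ q x - w ^ q 1\<close> equal to
  \<open>w - 1\<close>, a factor that cancels when \<open>w \<noteq> 1\<close>.\<close>

lemma exists_bij_betw_01:
  fixes n x :: nat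
  assumes "n \<ge> 2" "x \<in> {1..n}" "x \<noteq> 1"
  obtains q where "bij_betw q {1..n} {..<n}" "q x = 1" "q 1 = 0"
proof
  let ?q = "(\<lambda>v. v - 1) \<circ> transpose x 2"
  have "bij_betw (transpose x 2) {1..n} {1..n}"
    using assms by simp
  then show "bij_betw ?q {1..n} {..<n}"
    using bij_betw_pred_lessThan by (rule bij_betw_trans)
  show "?q x = 1" "?q 1 = 0" using assms by auto
qed

text \<open>Induction on \<open>j\<close> trades character factors for differences of indicators,
  one coordinate at a time. The bijections stay arbitrary because each step uses the induction
  hypothesis for two choices at coordinate \<open>j\<close>.\<close>

lemma COVP_box_sum_mixed:
  fixes p :: "nat \<Rightarrow> nat \<Rightarrow> nat" and w :: complex
  assumes covp: "planar_ap_COVP d n c" and n: "n \<ge> 2" and w: "w ^ n = 1" "w \<noteq> 1"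
    and x: "x \<in> tuples d n" and "j \<le> d"
    and p: "\<And>k. k < d \<Longrightarrow> bij_betw (p k) {1..n} {..<n}"
  shows "(\<Sum>y\<in>tuples d n. of_real (c y) *
           (\<Prod>k<j. of_bool (y ! k = x ! k) - of_bool (y ! k = 1)) * (\<Prod>k=j..<d. w ^ p k (y ! k))) = 0"
  using \<open>j \<le> d\<close> p
proof (induction j arbitrary: p)
  case 0
  then show ?case
    using COVP_character_sum[OF covp _ w, of p] n by (simp add: lessThan_atLeast0)
next
  case (Suc j)
  let ?e = "\<lambda>k v. of_bool (v = x ! k) - of_bool (v = 1) :: complex"
  let ?A = "\<lambda>y. of_real (c y) * (\<Prod>k<j. ?e k (y ! k))"
  let ?B = "\<lambda>y. \<Prod>k=Suc j..<d. w ^ p k (y ! k)"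
  have xj: "x ! j \<in> {1..n}" using nth_tuples x Suc.prems by auto
  show ?case
  proof (cases "x ! j = 1")
    \<comment> \<open>Both indicators coincide, so the new factor is identically zero.\<close>
    case True
    then show ?thesis by simp
  next
    case False
    obtain q where q: "bij_betw q {1..n} {..<n}" "q (x ! j) = 1" "q 1 = 0"
      using exists_bij_betw_01[OF n xj False] .
    have q': "bij_betw (q \<circ> transpose 1 (x ! j)) {1..n} {..<n}"
      by (rule bij_betw_trans[OF _ q(1)]) (use xj n in simp)
    have zero: "(\<Sum>y\<in>tuples d n. ?A y * (w ^ g (y ! j) * ?B y)) = 0"
      if g: "bij_betw g {1..n} {..<n}" for g
    proof -
      have "(\<Prod>k=j..<d. w ^ (p(j := g)) k (y ! k)) = w ^ g (y ! j) * ?B y" for y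
        using Suc.prems(1) by (simp add: prod.atLeast_Suc_lessThan)
      then show ?thesis
        using Suc.IH[of "p(j := g)"] Suc.prems g by simp
    qed
    \<comment> \<open>The two bijections differ only by exchanging their values 0 and 1 at the
      points \<open>1\<close> and \<open>x ! j\<close>.\<close>
    have diff: "w ^ q v - w ^ (q \<circ> transpose 1 (x ! j)) v = (w - 1) * ?e j v" for v
      using q False by (auto simp: transpose_def)
    have "(w - 1) * (\<Sum>y\<in>tuples d n. ?A y * ?e j (y ! j) * ?B y)
        = (\<Sum>y\<in>tuples d n. ?A y * (((w - 1) * ?e j (y ! j)) * ?B y))"
      unfolding sum_distrib_left by (intro sum.cong refl) (simp only: mult_ac)
    also have "\<dots> = (\<Sum>y\<in>tuples d n. ?A y * (w ^ q (y ! j) * ?B y))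
        - (\<Sum>y\<in>tuples d n. ?A y * (w ^ (q \<circ> transpose 1 (x ! j)) (y ! j) * ?B y))"
      unfolding diff[symmetric] sum_subtractf[symmetric]
      by (intro sum.cong refl) (simp only: left_diff_distrib right_diff_distrib)
    also have "\<dots> = 0"
      using zero[OF q(1)] zero[OF q'] by simp
    finally show ?thesis
      using w by (simp add: mult.assoc)
  qed
qed

text \<open>This is the case \<open>j = d\<close>, with no character factor left: an alternating sum
  of \<open>c\<close> over the corners of the box spanned by \<open>x\<close> and the all-ones
  tuple.\<close>

lemma COVP_box_sum:
  assumes covp: "planar_ap_COVP d n c" and n: "n \<ge> 2" and x: "x \<in> tuples d n"
  shows "(\<Sum>y\<in>tuples d n. c y * (\<Prod>k<d. of_bool (y ! k = x ! k) - of_bool (y ! k = 1))) = 0"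
proof -
  define w where "w = cis (2 * pi / n)"
  have w: "w ^ n = 1" using n by (simp add: w_def DeMoivre)
  \<comment> \<open>The indices 1 and 0 parametrize the roots of unity \<open>w\<close> and 1; they
    are distinct indices below \<open>n\<close> since \<open>n \<ge> 2\<close>.\<close>
  have "w \<noteq> 1"
    using inj_onD[OF bij_betw_imp_inj_on[OF bij_betw_roots_unity[of n]], of 1 0] n
    by (auto simp: w_def)
  then have "(\<Sum>y\<in>tuples d n. complex_of_real (c y) *
      (\<Prod>k<d. of_bool (y ! k = x ! k) - of_bool (y ! k = 1))) = 0"
    using COVP_box_sum_mixed[OF covp n w _ x order_refl bij_betw_pred_lessThan] by simp
  moreover have "complex_of_real (of_bool P) = of_bool P" for P
    by (cases P) auto
  ultimately have "complex_of_real (\<Sum>y\<in>tuples d n. c y *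
      (\<Prod>k<d. of_bool (y ! k = x ! k) - of_bool (y ! k = 1))) = 0"
    by simp
  then show ?thesis by (simp only: of_real_eq_0_iff)
qed

section \<open>Telescoping into arrays that ignore one coordinate\<close>

lemma prod_diff_telescope:
  fixes p q :: "nat \<Rightarrow> 'a :: comm_ring_1"
  shows "(\<Prod>k<d. p k) - (\<Prod>k<d. p k - q k) =
    (\<Sum>k<d. (\<Prod>i<k. p i) * q k * (\<Prod>i\<in>{k<..<d}. p i - q i))"
proof (induction d)
  case (Suc d)
  have ivl: "{d<..<Suc d} = {}" "\<And>k. k < d \<Longrightarrow> {k<..<Suc d} = insert d {k<..<d}"
    by auto
  \<comment> \<open>Every old summand gains the last difference as a factor, while the new summand
    has an empty tail product.\<close>
  have "(\<Sum>k<Suc d. (\<Prod>i<k. p i) * q k * (\<Prod>i\<in>{k<..<Suc d}. p i - q i))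
      = (\<Sum>k<d. (\<Prod>i<k. p i) * q k * (\<Prod>i\<in>{k<..<d}. p i - q i)) * (p d - q d)
        + (\<Prod>i<d. p i) * q d"
    by (simp add: sum_distrib_left ivl mult_ac)
  then show ?case
    unfolding Suc.IH[symmetric] by (simp add: algebra_simps)
qed simp

text \<open>Pairing \<open>c\<close> with the indicator of \<open>x\<close>, a product of coordinate
  deltas, gives \<open>c x\<close>. The vanishing box sum may be subtracted, and telescoping then
  leaves a \<open>k\<close>-th summand that never reads \<open>x ! k\<close>.\<close>

lemma COVP_imp_sum_decomposable:
  assumes covp: "planar_ap_COVP d n c" and n: "n \<ge> 2"
  shows "sum_decomposable d n c"
proof -
  let ?d = "\<lambda>a b :: nat. of_bool (a = b) :: real"
  \<comment> \<open>Deletion shifts the entries after position \<open>k\<close> down by one, hence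
    \<open>i - 1\<close> in the tail; the factor at \<open>k\<close> compares with the base value 1
    instead of the deleted entry.\<close>
  define a where "a k z = (\<Sum>y\<in>tuples d n. c y * ((\<Prod>i<k. ?d (y ! i) (z ! i)) * ?d (y ! k) 1 *
      (\<Prod>i\<in>{k<..<d}. ?d (y ! i) (z ! (i - 1)) - ?d (y ! i) 1)))" for k z
  have "c x = (\<Sum>k<d. a k (drop_coord k x))" if x: "x \<in> tuples d n" for x
  proof -
    have len: "length x = d" using x by (simp add: tuples_def)
    have delta: "(\<Prod>k<d. ?d (y ! k) (x ! k)) = of_bool (y = x)" if "y \<in> tuples d n" for y
      using that len by (auto simp: tuples_def list_eq_iff_nth_eq prod_zero_iff)
    have "c x = (\<Sum>y\<in>tuples d n. c y * (\<Prod>k<d. ?d (y ! k) (x ! k)))"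
      using x finite_tuples by (simp add: delta of_bool_def[of "_ = x"] if_distrib sum.delta cong: if_cong)
    also have "\<dots> = (\<Sum>y\<in>tuples d n. c y * ((\<Prod>k<d. ?d (y ! k) (x ! k))
        - (\<Prod>k<d. ?d (y ! k) (x ! k) - ?d (y ! k) 1)))"
      using COVP_box_sum[OF covp n x] by (simp add: right_diff_distrib sum_subtractf)
    also have "\<dots> = (\<Sum>y\<in>tuples d n. \<Sum>k<d. c y * ((\<Prod>i<k. ?d (y ! i) (x ! i)) * ?d (y ! k) 1 *
      (\<Prod>i\<in>{k<..<d}. ?d (y ! i) (x ! i) - ?d (y ! i) 1)))"
      by (simp only: prod_diff_telescope sum_distrib_left)
    also have "\<dots> = (\<Sum>k<d. \<Sum>y\<in>tuples d n. c y * ((\<Prod>i<k. ?d (y ! i) (x ! i)) * ?d (y ! k) 1 *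
      (\<Prod>i\<in>{k<..<d}. ?d (y ! i) (x ! i) - ?d (y ! i) 1)))"
      by (rule sum.swap)
    also have "\<dots> = (\<Sum>k<d. a k (drop_coord k x))"
      unfolding a_def
      by (intro sum.cong refl arg_cong2[where f = "(*)"] prod.cong)
        (simp_all add: nth_drop_coord_below nth_drop_coord_above len del: One_nat_def)
    finally show ?thesis .
  qed
  then show ?thesis unfolding sum_decomposable_def by blast
qed

theorem theorem2p9:
  fixes d n :: nat and c :: "nat list \<Rightarrow> real"
  assumes "d \<ge> 2" and "n \<ge> 2"
  shows "planar_ap_COVP d n c \<longleftrightarrow> sum_decomposable d n c"
  using COVP_imp_sum_decomposable sum_decomposable_imp_COVP assms by blast

end
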